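(* Let $N\ge 3$ be an integer, and let $C_N$ denote a configuration consisting of $N$ pieces sitting at the $N$ vertices of a regular $N$-gon in the plane $\mathbf{R}^2$ (one piece at each vertex). In a legal move, any piece can jump over any other piece and land at the point centrally symmetric about it. If $N\notin\{3,4,6\}$, then there is a finite sequence of legal moves that takes the pieces of $C_N$ into a strictly larger similar configuration.
   Context: A configuration of $N$ pieces in $\mathbf{R}^2$ is an $N$-tuple $(p_0,\dots,p_{N-1})$ of points of $\mathbf{R}^2$, where $p_i$ is the position of piece $i$; several pieces are allowed to occupy the same point at the same time. A legal move chooses two different pieces $i\neq j$ and replaces $p_i$ by $2p_j-p_i$ (piece $i$ jumps over piece $j$), leaving all other positions unchanged. A configuration $(q_0,\dots,q_{N-1})$ is similar to and (strictly) larger than $(p_0,\dots,p_{N-1})$ if there are a real number $\lambda$ with $|\lambda|>1$, an orthogonal $2\times 2$ matrix $S$ and a vector $v\in\mathbf{R}^2$ such that $q_i=\lambda S p_i+v$ for all $i$. *)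

theory Defs
  imports "HOL-Analysis.Analysis"
begin

text \<open>A configuration of \<open>N\<close> pieces is a function \<open>p :: nat \<Rightarrow> real^2\<close> of which only the values
  \<open>p 0, \<dots>, p (N - 1)\<close> are meaningful; moves never touch the other values and similarity
  ignores them.\<close>

type_synonym config = "nat \<Rightarrow> real^2"

inductive legal_move :: "nat \<Rightarrow> config \<Rightarrow> config \<Rightarrow> bool" for N :: nat where
  jump: "i < N \<Longrightarrow> j < N \<Longrightarrow> i \<noteq> j \<Longrightarrow> legal_move N p (p(i := 2 *\<^sub>R p j - p i))"

definition similar_larger :: "nat \<Rightarrow> config \<Rightarrow> config \<Rightarrow> bool" where
  "similar_larger N p q \<longleftrightarrow>
     (\<exists>(l::real) (S::real^2^2) (v::real^2).
        \<bar>l\<bar> > 1 \<and> orthogonal_matrix S \<and> (\<forall>i<N. q i = l *\<^sub>R (S *v p i) + v))"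

definition regular_polygon_vertices :: "nat \<Rightarrow> real^2 \<Rightarrow> real \<Rightarrow> real \<Rightarrow> (real^2) set" where
  "regular_polygon_vertices N c r \<theta> =
     (\<lambda>k::nat. c + r *\<^sub>R vector [cos (\<theta> + 2 * pi * real k / real N),
                                sin (\<theta> + 2 * pi * real k / real N)]) ` {..<N}"

text \<open>Centre, circumradius, rotation and the assignment of the pieces to the vertices are all
  arbitrary; in particular the pieces need not be numbered in cyclic order.\<close>

definition regular_polygon_config :: "nat \<Rightarrow> config \<Rightarrow> bool" where
  "regular_polygon_config N p \<longleftrightarrow>
     (\<exists>c r \<theta>. r > 0 \<and> bij_betw p {..<N} (regular_polygon_vertices N c r \<theta>))"

end

theory Submission
  imports Defs "HOL-Computational_Algebra.Polynomial"
begin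

text \<open>Keep piece 0 fixed and record the other pieces by integer row vectors with respect to the
  differences \<open>C j - C 0\<close>. Jumps over piece 0 negate a row, and combining them with other jumps
  adds even multiples of one row to another; by a Euclidean algorithm these operations
  reach every integer matrix that is invertible and congruent to the identity modulo 2.

  It remains to realise an enlargement by such a matrix. The differences are a scaled
  specialisation, at a primitive \<open>N\<close>-th root of unity \<open>z\<close>, of the basis \<open>X ^ j - 1\<close> of the
  augmentation ideal of \<open>\<int>[X] / (X ^ N - 1)\<close>. For \<open>k\<close> coprime to \<open>N\<close>, multiplication by
  \<open>1 + X + \<dots> + X ^ (k - 1)\<close> is invertible on this ideal, and by the pigeonhole principle some
  power of it is the identity modulo 2. It multiplies the polygon by a power of
  \<open>(z ^ k - 1) / (z - 1)\<close>, which has modulus greater than 1 as soon as \<open>1 < k < N / 2\<close>; such a \<open>k\<close>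
  exists unless \<open>N\<close> is 3, 4 or 6.\<close>

subsection \<open>Row operations by jumps\<close>

text \<open>Point reflection is an involution: repeating the jump undoes it.\<close>

lemma legal_move_sym:
  assumes "legal_move N p q"
  shows "legal_move N q p"
  using assms
proof cases
  case (jump i j)
  have "p = q(i := 2 *\<^sub>R q j - q i)"
    using jump by (simp add: fun_eq_iff)
  then show ?thesis
    using legal_move.jump[of i N j q] jump by simp
qed

lemma legal_moves_sym:
  assumes "(legal_move N)\<^sup>*\<^sup>* p q"
  shows "(legal_move N)\<^sup>*\<^sup>* q p"
  using assms
  by (induction rule: rtranclp_induct) (auto intro: converse_rtranclp_into_rtranclp legal_move_sym)

text \<open>The coordinates \<open>y i j\<close> are formal: the differences
  \<open>C j - C 0\<close> may be linearly dependent, so elimination works on the matrix rather than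
  on the points.\<close>

definition combine :: "nat \<Rightarrow> config \<Rightarrow> (nat \<Rightarrow> nat \<Rightarrow> int) \<Rightarrow> config" where
  "combine N C y i =
     (if i \<in> {1..<N} then C 0 + (\<Sum>j\<in>{1..<N}. of_int (y i j) *\<^sub>R (C j - C 0)) else C i)"

text \<open>The factor 2 is built in because jumps preserve the rows modulo 2.\<close>

definition row_op :: "(nat \<Rightarrow> nat \<Rightarrow> int) \<Rightarrow> nat \<Rightarrow> int \<Rightarrow> nat \<Rightarrow> int \<Rightarrow> (nat \<Rightarrow> nat \<Rightarrow> int)" where
  "row_op y i s k t = y(i := \<lambda>j. s * y i j + 2 * t * y k j)"

text \<open>Piece \<open>i\<close> jumps over piece 0, the origin of the coordinates.\<close>

lemma combine_negate_row:
  assumes "i \<in> {1..<N}" "k \<noteq> i"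
  shows "legal_move N (combine N C y) (combine N C (row_op y i (-1) k 0))"
proof -
  have "(\<Sum>j\<in>{1..<N}. of_int (row_op y i (-1) k 0 i j) *\<^sub>R (C j - C 0))
      = - (\<Sum>j\<in>{1..<N}. of_int (y i j) *\<^sub>R (C j - C 0))"
    by (simp add: row_op_def flip: sum_negf)
  then have "combine N C (row_op y i (-1) k 0)
      = (combine N C y)(i := 2 *\<^sub>R combine N C y 0 - combine N C y i)"
    using assms by (simp add: combine_def row_op_def fun_eq_iff scaleR_2)
  then show ?thesis
    using legal_move.jump[of i N 0 "combine N C y"] assms by simp
qed

lemma combine_reflect_row:
  assumes "i \<in> {1..<N}" "k \<in> {1..<N}" "k \<noteq> i"
  shows "legal_move N (combine N C y) (combine N C (row_op y i (-1) k 1))"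
proof -
  have "(\<Sum>j\<in>{1..<N}. of_int (row_op y i (-1) k 1 i j) *\<^sub>R (C j - C 0))
      = 2 *\<^sub>R (\<Sum>j\<in>{1..<N}. of_int (y k j) *\<^sub>R (C j - C 0))
        - (\<Sum>j\<in>{1..<N}. of_int (y i j) *\<^sub>R (C j - C 0))"
    by (simp add: row_op_def scaleR_left_diff_distrib scaleR_sum_right flip: sum_subtractf)
  then have "combine N C (row_op y i (-1) k 1)
      = (combine N C y)(i := 2 *\<^sub>R combine N C y k - combine N C y i)"
    using assms by (simp add: combine_def row_op_def fun_eq_iff scaleR_2)
  then show ?thesis
    using legal_move.jump[of i N k "combine N C y"] assms by simp
qed

lemma row_op_row_op:
  assumes "k \<noteq> i"
  shows "row_op (row_op y i s k t) i s' k t' = row_op y i (s' * s) k (s' * t + t')"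
  using assms by (auto simp: row_op_def fun_eq_iff algebra_simps)

text \<open>A jump over piece 0 followed by one over piece \<open>k\<close> adds twice row
  \<open>k\<close> to row \<open>i\<close>. Repetition, with reversed moves for negative
  \<open>t\<close>, gives every even multiple; one more jump over piece 0 gives the sign -1.\<close>

lemma combine_row_op:
  assumes ik: "i \<in> {1..<N}" "k \<in> {1..<N}" "k \<noteq> i" and s: "s \<in> {1, -1}"
  shows "(legal_move N)\<^sup>*\<^sup>* (combine N C y) (combine N C (row_op y i s k t))"
proof -
  have up: "(legal_move N)\<^sup>*\<^sup>* (combine N C z) (combine N C (row_op z i 1 k 1))" for z
    using combine_negate_row[OF ik(1,3), of C z]
      combine_reflect_row[OF ik, of C "row_op z i (-1) k 0"] ik(3)
    by (simp add: row_op_row_op)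
  have add: "(legal_move N)\<^sup>*\<^sup>* (combine N C y) (combine N C (row_op y i 1 k t))" for t
  proof (induction t rule: int_induct[of _ 0])
    case base
    show ?case by (simp add: row_op_def)
  next
    case (step1 t)
    then show ?case
      using up[of "row_op y i 1 k t"] ik(3) by (simp add: row_op_row_op)
  next
    case (step2 t)
    then show ?case
      using legal_moves_sym[OF up[of "row_op y i 1 k (t - 1)"]] ik(3) by (simp add: row_op_row_op)
  qed
  show ?thesis
  proof (cases "s = 1")
    case False
    \<comment> \<open>The final negation also flips the added multiple, hence
      \<open>-t\<close>.\<close>
    then show ?thesis
      using s add[of "-t"] combine_negate_row[OF ik(1,3), of C "row_op y i 1 k (-t)"] ik(3)
      by (simp add: row_op_row_op)
  qed (use add in simp)
qed

section \<open>Integer matrices invertible and congruent to the identity modulo 2\<close>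

text \<open>Invertibility as the existence of an integral left inverse, given row by row through the
  coefficients \<open>b\<close>; this avoids determinants.\<close>

definition unimodular :: "nat \<Rightarrow> (nat \<Rightarrow> nat \<Rightarrow> int) \<Rightarrow> bool" where
  "unimodular N y \<longleftrightarrow> (\<forall>c\<in>{1..<N}. \<exists>b. \<forall>j\<in>{1..<N}.
     (\<Sum>i\<in>{1..<N}. b i * y i j) = (if j = c then 1 else 0))"

definition odd_diagonal :: "nat \<Rightarrow> (nat \<Rightarrow> nat \<Rightarrow> int) \<Rightarrow> bool" where
  "odd_diagonal N y \<longleftrightarrow> (\<forall>i\<in>{1..<N}. \<forall>j\<in>{1..<N}. odd (y i j) \<longleftrightarrow> i = j)"

lemma unimodular_row_op:
  assumes "unimodular N y" and ik: "i \<in> {1..<N}" "k \<in> {1..<N}" "k \<noteq> i" and s: "s \<in> {1, -1}"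
  shows "unimodular N (row_op y i s k t)"
  unfolding unimodular_def
proof
  fix c assume "c \<in> {1..<N}"
  then obtain b where b: "\<And>j. j \<in> {1..<N} \<Longrightarrow>
      (\<Sum>r\<in>{1..<N}. b r * y r j) = (if j = c then 1 else 0)"
    using assms(1) unfolding unimodular_def by meson
  \<comment> \<open>The coefficients undergo the inverse operation: \<open>s\<close> is its own
    inverse, and the change at \<open>k\<close> cancels the multiple of row \<open>k\<close> added
    to row \<open>i\<close>.\<close>
  define b' where "b' = b(i := s * b i, k := b k - 2 * t * s * b i)"
  have ss: "s * s = 1" using s by auto
  have "(\<Sum>r\<in>{1..<N}. b' r * row_op y i s k t r j) = (if j = c then 1 else 0)"
    if "j \<in> {1..<N}" for j
  proof -
    have "b' r * row_op y i s k t r j = b r * y r j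
        + (if r = i then 2 * t * s * b i * y k j else 0)
        - (if r = k then 2 * t * s * b i * y k j else 0)" for r
    proof (cases "r = i")
      case True
      have "s * b i * (s * y i j + 2 * t * y k j) = (s * s) * (b i * y i j) + 2 * t * s * b i * y k j"
        by (simp add: algebra_simps)
      with True ik(3) ss show ?thesis by (simp add: b'_def row_op_def)
    qed (use ik(3) in \<open>auto simp: b'_def row_op_def algebra_simps\<close>)
    then show ?thesis
      using ik b[OF that] by (simp add: sum.distrib sum_subtractf)
  qed
  then show "\<exists>b. \<forall>j\<in>{1..<N}. (\<Sum>r\<in>{1..<N}. b r * row_op y i s k t r j) = (if j = c then 1 else 0)"
    by blast
qed

lemma odd_diagonal_row_op:
  assumes "odd_diagonal N y" "s \<in> {1, -1}"
  shows "odd_diagonal N (row_op y i s k t)"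
  using assms by (auto simp: odd_diagonal_def row_op_def)

definition unit_column :: "nat \<Rightarrow> (nat \<Rightarrow> nat \<Rightarrow> int) \<Rightarrow> nat \<Rightarrow> bool" where
  "unit_column N y j \<longleftrightarrow> (\<forall>i\<in>{1..<N}. y i j = (if i = j then 1 else 0))"

lemma unit_column_row_op:
  assumes "unit_column N y j" "k \<in> {1..<N}" "k \<noteq> j" "i \<noteq> j \<or> s = 1"
  shows "unit_column N (row_op y i s k t) j"
  using assms by (auto simp: unit_column_def row_op_def)

section \<open>Elimination with even multiples\<close>

text \<open>Adding or subtracting \<open>2 * b\<close> against the sign of \<open>a\<close> leaves
  modulus \<open>\<bar>\<bar>a\<bar> - 2 * \<bar>b\<bar>\<bar>\<close>, which is below
  \<open>\<bar>a\<bar>\<close> because \<open>0 < \<bar>b\<bar> < \<bar>a\<bar>\<close>.\<close>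

lemma abs_add_twice_less:
  fixes a b :: int
  assumes "b \<noteq> 0" "\<bar>b\<bar> < \<bar>a\<bar>"
  shows "\<exists>t. \<bar>a + 2 * t * b\<bar> < \<bar>a\<bar>"
proof (cases "(a > 0) = (b > 0)")
  case True
  then show ?thesis using assms by (intro exI[of _ "-1"]) auto
next
  case False
  then show ?thesis using assms by (intro exI[of _ 1]) auto
qed

text \<open>In a combination of the rows giving the unit vector at \<open>c\<close>, the cleared
  columns force the coefficients before \<open>c\<close> to vanish. Column \<open>c\<close> then
  reads \<open>b c * y c c = 1\<close>.\<close>

lemma unimodular_pivot:
  assumes uni: "unimodular N y" and c: "c \<in> {1..<N}"
    and left: "\<And>j. j \<in> {1..<c} \<Longrightarrow> unit_column N y j"
    and below: "\<And>r. r \<in> {c<..<N} \<Longrightarrow> y r c = 0"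
  shows "\<bar>y c c\<bar> = 1"
proof -
  obtain b where b: "\<And>j. j \<in> {1..<N} \<Longrightarrow>
      (\<Sum>r\<in>{1..<N}. b r * y r j) = (if j = c then 1 else 0)"
    using uni c unfolding unimodular_def by meson
  have b0: "b j = 0" if j: "j \<in> {1..<c}" for j
  proof -
    have "(\<Sum>r\<in>{1..<N}. b r * y r j) = (\<Sum>r\<in>{1..<N}. if r = j then b r else 0)"
      using left[OF j] by (intro sum.cong) (auto simp: unit_column_def)
    with b[of j] j c show ?thesis by auto
  qed
  have "b r * y r c = (if r = c then b c * y c c else 0)" if "r \<in> {1..<N}" for r
    using that b0[of r] below[of r] by (cases r c rule: linorder_cases) auto
  then have "(\<Sum>r\<in>{1..<N}. b r * y r c) = (\<Sum>r\<in>{1..<N}. if r = c then b c * y c c else 0)"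
    by (rule sum.cong[OF refl])
  with b[OF c] c have "b c * y c c = 1" by simp
  then show ?thesis
    by (metis abs_one dvd_triv_right zdvd1_eq)
qed

text \<open>Euclidean descent on the sum of the moduli in column \<open>c\<close>. Entries below the
  pivot are removed first; then the pivot is a unit and reduces those above.\<close>

lemma clear_column:
  assumes c: "c \<in> {1..<N}" and "unimodular N y" "odd_diagonal N y"
    and "\<And>j. j \<in> {1..<c} \<Longrightarrow> unit_column N y j"
  shows "\<exists>z. (legal_move N)\<^sup>*\<^sup>* (combine N C y) (combine N C z) \<and> unimodular N z
    \<and> odd_diagonal N z \<and> (\<forall>j\<in>{1..<c}. unit_column N z j) \<and> (\<forall>r\<in>{1..<N}. r \<noteq> c \<longrightarrow> z r c = 0)"
  using assms(2-)
proof (induction "\<Sum>r\<in>{1..<N}. nat \<bar>y r c\<bar>" arbitrary: y rule: less_induct)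
  case less
  show ?case
  proof (cases "\<forall>r\<in>{1..<N}. r \<noteq> c \<longrightarrow> y r c = 0")
    case True
    with less.prems show ?thesis by blast
  next
    case False
    have parity: "odd (y r c) \<longleftrightarrow> r = c" if "r \<in> {1..<N}" for r
      using less.prems(2) c that by (auto simp: odd_diagonal_def)
    \<comment> \<open>The pivot is odd and every other entry of the column even, so the pivot never has the same modulus
      as another entry; \<open>k \<ge> c\<close> protects the columns already cleared.\<close>
    obtain i k where ik: "i \<in> {1..<N}" "k \<in> {c..<N}" "k \<noteq> i"
      and small: "y k c \<noteq> 0" "\<bar>y k c\<bar> < \<bar>y i c\<bar>"
    proof (cases "\<exists>r\<in>{c<..<N}. y r c \<noteq> 0")
      case True
      then obtain r where r: "r \<in> {c<..<N}" "y r c \<noteq> 0" by blast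
      have "\<bar>y r c\<bar> \<noteq> \<bar>y c c\<bar>" "y c c \<noteq> 0"
        using parity[of r] parity[of c] r c by (auto simp: abs_eq_iff)
      then show ?thesis
        using that[of r c] that[of c r] r c by fastforce
    next
      \<comment> \<open>Only entries above the pivot remain. They are even, so the nonzero ones
        exceed the unit pivot in modulus.\<close>
      assume none: "\<not> (\<exists>r\<in>{c<..<N}. y r c \<noteq> 0)"
      then have "\<bar>y c c\<bar> = 1"
        using unimodular_pivot[OF less.prems(1) c] less.prems(3) by blast
      moreover obtain r where r: "r \<in> {1..<N}" "r \<noteq> c" "y r c \<noteq> 0"
        using False by blast
      moreover have "\<bar>y r c\<bar> \<noteq> 1"
        using parity[of r] r by auto
      ultimately show ?thesis
        using that[of r c] c by fastforce
    qed
    obtain t where t: "\<bar>y i c + 2 * t * y k c\<bar> < \<bar>y i c\<bar>"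
      using abs_add_twice_less[OF small] by blast
    let ?z = "row_op y i 1 k t"
    have k: "k \<in> {1..<N}" using ik c by auto
    have "(\<Sum>r\<in>{1..<N}. nat \<bar>?z r c\<bar>) < (\<Sum>r\<in>{1..<N}. nat \<bar>y r c\<bar>)"
      using t ik by (intro sum_strict_mono_ex1) (auto simp: row_op_def intro!: bexI[of _ i])
    moreover have "unimodular N ?z"
      using unimodular_row_op[OF less.prems(1) ik(1) k ik(3)] by simp
    moreover have "odd_diagonal N ?z"
      using odd_diagonal_row_op[OF less.prems(2)] by simp
    moreover have "unit_column N ?z j" if "j \<in> {1..<c}" for j
      using unit_column_row_op[OF less.prems(3)[OF that] k] ik that by auto
    ultimately obtain z where z: "(legal_move N)\<^sup>*\<^sup>* (combine N C ?z) (combine N C z)"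
      "unimodular N z" "odd_diagonal N z" "\<forall>j\<in>{1..<c}. unit_column N z j"
      "\<forall>r\<in>{1..<N}. r \<noteq> c \<longrightarrow> z r c = 0"
      using less.hyps[of ?z] by blast
    have "(legal_move N)\<^sup>*\<^sup>* (combine N C y) (combine N C ?z)"
      using combine_row_op[OF ik(1) k ik(3)] by simp
    with z show ?thesis
      by (meson rtranclp_trans)
  qed
qed

lemma reach_unit_columns:
  assumes "N \<ge> 3" "unimodular N y" "odd_diagonal N y" "c \<le> N"
  shows "\<exists>z. (legal_move N)\<^sup>*\<^sup>* (combine N C y) (combine N C z) \<and> unimodular N z
    \<and> odd_diagonal N z \<and> (\<forall>j\<in>{1..<c}. unit_column N z j)"
  using \<open>c \<le> N\<close>
proof (induction c)
  case 0
  show ?case using assms by auto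
next
  case (Suc c)
  then obtain z where z: "(legal_move N)\<^sup>*\<^sup>* (combine N C y) (combine N C z)"
    "unimodular N z" "odd_diagonal N z" "\<forall>j\<in>{1..<c}. unit_column N z j"
    by auto
  show ?case
  proof (cases "c = 0")
    case True
    then show ?thesis using z by auto
  next
    case False
    with Suc.prems have c: "c \<in> {1..<N}" by auto
    obtain w where w: "(legal_move N)\<^sup>*\<^sup>* (combine N C z) (combine N C w)"
      "unimodular N w" "odd_diagonal N w" "\<forall>j\<in>{1..<c}. unit_column N w j"
      "\<forall>r\<in>{1..<N}. r \<noteq> c \<longrightarrow> w r c = 0"
      using clear_column[OF c z(2,3)] z(4) by blast
    have "\<bar>w c c\<bar> = 1"
      using unimodular_pivot[OF w(2) c] w(4,5) by auto
    then have s: "w c c \<in> {1, -1}" by auto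
    obtain k where k: "k \<in> {1..<N}" "k \<noteq> c"
      using assms(1) that[of 1] that[of 2] by fastforce
    \<comment> \<open>Multiplying row \<open>c\<close> by its own pivot, which is 1 or -1, makes the
      pivot 1. The second index \<open>k\<close> exists because \<open>N \<ge> 3\<close>.\<close>
    let ?w = "row_op w c (w c c) k 0"
    have "unit_column N ?w j" if "j \<in> {1..<Suc c}" for j
    proof (cases "j = c")
      case True
      then show ?thesis
        using w(5) s by (auto simp: row_op_def unit_column_def)
    next
      case False
      then have "unit_column N w j" using w(4) that by simp
      then show ?thesis
        using c False by (auto simp: row_op_def unit_column_def)
    qed
    moreover have "(legal_move N)\<^sup>*\<^sup>* (combine N C w) (combine N C ?w)"
      using combine_row_op[OF c k s] .
    moreover have "unimodular N ?w"
      using unimodular_row_op[OF w(2) c k s] .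
    moreover have "odd_diagonal N ?w"
      using odd_diagonal_row_op[OF w(3) s] .
    ultimately show ?thesis
      using z(1) w(1) by (meson rtranclp_trans)
  qed
qed

lemma combine_unit_columns:
  assumes "\<forall>j\<in>{1..<N}. unit_column N z j"
  shows "combine N C z = C"
proof
  fix i
  show "combine N C z i = C i"
  proof (cases "i \<in> {1..<N}")
    case True
    have "(\<Sum>j\<in>{1..<N}. of_int (z i j) *\<^sub>R (C j - C 0))
        = (\<Sum>j\<in>{1..<N}. if i = j then C j - C 0 else 0)"
      using assms True by (intro sum.cong) (auto simp: unit_column_def)
    also have "\<dots> = C i - C 0"
      using True by (subst sum.delta') auto
    finally show ?thesis using True by (simp add: combine_def)
  qed (auto simp: combine_def)
qed

text \<open>Elimination leads from the matrix \<open>y\<close> to the identity, that is, to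
  \<open>C\<close>; moves are reversible.\<close>

lemma legal_moves_combine:
  assumes "N \<ge> 3" "unimodular N y" "odd_diagonal N y"
  shows "(legal_move N)\<^sup>*\<^sup>* C (combine N C y)"
  using reach_unit_columns[OF assms order.refl, of C] combine_unit_columns[of N _ C]
  by (metis legal_moves_sym)

subsection \<open>The augmentation ideal and cyclotomic units\<close>

abbreviation X :: "int poly" where
  "X \<equiv> [:0, 1:]"

text \<open>Modulo \<open>X ^ N - 1\<close> the polynomials \<open>X ^ j - 1\<close> form a basis of
  the ideal of polynomials vanishing at 1. Congruence is written as divisibility, so no quotient
  ring is formed.\<close>

definition augmentation_comb :: "nat \<Rightarrow> (nat \<Rightarrow> int) \<Rightarrow> int poly" where
  "augmentation_comb N a = (\<Sum>j\<in>{1..<N}. of_int (a j) * (X ^ j - 1))"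

lemma power_minus_one_dvd:
  fixes x :: "'a::comm_ring_1"
  shows "x - 1 dvd x ^ n - 1"
  by (simp add: power_diff_1_eq)

lemma X_power_mod:
  "X ^ N - 1 dvd X ^ d - X ^ (d mod N)"
proof -
  have "X ^ d = X ^ (N * (d div N) + d mod N)" by simp
  also have "\<dots> = (X ^ N) ^ (d div N) * X ^ (d mod N)"
    by (simp only: power_add power_mult)
  finally have "X ^ d - X ^ (d mod N) = ((X ^ N) ^ (d div N) - 1) * X ^ (d mod N)"
    by (simp only: left_diff_distrib mult_1)
  then show ?thesis
    by (simp only: power_minus_one_dvd dvd_mult2)
qed

text \<open>The coefficients of \<open>f\<close> sum to 0, so each \<open>X ^ d\<close> may be
  replaced by \<open>X ^ d - 1\<close>; then exponents are reduced modulo \<open>N\<close> and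
  grouped by residue.\<close>

lemma augmentation_rep:
  assumes "N > 0" "poly f 1 = 0"
  shows "\<exists>a. X ^ N - 1 dvd f - augmentation_comb N a"
proof -
  define D where "D = {..degree f}"
  define a where "a j = (\<Sum>d | d \<in> D \<and> d mod N = j. coeff f d)" for j
  have fin: "finite D" by (simp add: D_def)
  have f: "f = (\<Sum>d\<in>D. of_int (coeff f d) * X ^ d)"
    by (subst (1) poly_as_sum_of_monoms[of f, symmetric])
      (simp add: D_def monom_altdef of_int_poly)
  have "of_int (\<Sum>d\<in>D. coeff f d) = (0 :: int poly)"
    using assms(2) by (simp add: poly_altdef D_def)
  then have "f = (\<Sum>d\<in>D. of_int (coeff f d) * (X ^ d - 1))"
    by (subst f) (simp add: right_diff_distrib sum_subtractf flip: of_int_sum)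
  moreover have "augmentation_comb N a = (\<Sum>d\<in>D. of_int (coeff f d) * (X ^ (d mod N) - 1))"
  proof -
    \<comment> \<open>The term for \<open>j = 0\<close> is \<open>X ^ 0 - 1 = 0\<close>.\<close>
    have "augmentation_comb N a = (\<Sum>j<N. of_int (a j) * (X ^ j - 1))"
      unfolding augmentation_comb_def using assms(1)
      by (intro sum.mono_neutral_left) (auto simp: not_le)
    also have "\<dots> = (\<Sum>j<N. \<Sum>d | d \<in> D \<and> d mod N = j. of_int (coeff f d) * (X ^ (d mod N) - 1))"
      unfolding a_def of_int_sum sum_distrib_right by (intro sum.cong) auto
    also have "\<dots> = (\<Sum>d\<in>D. of_int (coeff f d) * (X ^ (d mod N) - 1))"
      using fin assms(1) by (intro sum.group) auto
    finally show ?thesis .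
  qed
  ultimately have "f - augmentation_comb N a = (\<Sum>d\<in>D. of_int (coeff f d) * (X ^ d - 1))
      - (\<Sum>d\<in>D. of_int (coeff f d) * (X ^ (d mod N) - 1))"
    by (rule arg_cong2)
  also have "\<dots> = (\<Sum>d\<in>D. of_int (coeff f d) * (X ^ d - X ^ (d mod N)))"
    by (simp add: right_diff_distrib sum_subtractf)
  finally have "X ^ N - 1 dvd f - augmentation_comb N a"
    by (metis (no_types, lifting) X_power_mod dvd_mult dvd_sum)
  then show ?thesis by blast
qed

lemma coeff_augmentation_comb:
  assumes "n > 0"
  shows "coeff (augmentation_comb N a) n = (if n < N then a n else 0)"
proof -
  have "coeff (augmentation_comb N a) n = (\<Sum>j\<in>{1..<N}. if j = n then a n else 0)"
    unfolding augmentation_comb_def coeff_sum using assms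
    by (intro sum.cong) (auto simp: of_int_poly simp flip: monom_altdef[of 1, simplified])
  also have "\<dots> = (if n < N then a n else 0)"
    using assms by auto
  finally show ?thesis .
qed

text \<open>The combination has degree below \<open>N\<close>, so a multiple of
  \<open>X ^ N - 1\<close> among such combinations is zero.\<close>

lemma augmentation_comb_unique:
  assumes "X ^ N - 1 dvd augmentation_comb N a" "j \<in> {1..<N}"
  shows "a j = 0"
proof -
  have "N > 0" using assms(2) by auto
  have "coeff (X ^ N - 1) N = 1"
    using \<open>N > 0\<close> by (simp flip: monom_altdef[of 1, simplified])
  then have "degree (X ^ N - 1) \<ge> N"
    by (intro le_degree) simp
  moreover have "degree (augmentation_comb N a) < N"
    using \<open>N > 0\<close> coeff_augmentation_comb[of _ N a]
    by (intro degree_lessI) auto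
  ultimately have "augmentation_comb N a = 0"
    using dvd_imp_degree_le[OF assms(1)] by linarith
  then show ?thesis
    using coeff_augmentation_comb[of j N a] assms(2) by simp
qed

lemma augmentation_comb_diff:
  "augmentation_comb N a - augmentation_comb N b = augmentation_comb N (\<lambda>j. a j - b j)"
  by (simp add: augmentation_comb_def algebra_simps flip: sum_subtractf)

lemma augmentation_comb_cmult:
  "of_int c * augmentation_comb N a = augmentation_comb N (\<lambda>j. c * a j)"
  by (simp add: augmentation_comb_def sum_distrib_left mult.assoc)

lemma augmentation_comb_unit:
  assumes "i \<in> {1..<N}"
  shows "augmentation_comb N (\<lambda>j. if j = i then 1 else 0) = X ^ i - 1"
proof -
  have "augmentation_comb N (\<lambda>j. if j = i then 1 else 0)
      = (\<Sum>j\<in>{1..<N}. if j = i then X ^ i - 1 else 0)"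
    unfolding augmentation_comb_def by (intro sum.cong) auto
  also have "\<dots> = X ^ i - 1"
    using assms by simp
  finally show ?thesis .
qed

lemma augmentation_comb_sum:
  "(\<Sum>i\<in>A. of_int (b i) * augmentation_comb N (y i)) = augmentation_comb N (\<lambda>j. \<Sum>i\<in>A. b i * y i j)"
  unfolding augmentation_comb_def of_int_sum sum_distrib_left sum_distrib_right
  by (subst sum.swap) (simp add: mult.assoc)

section \<open>Transfer of integer polynomials to other coefficient rings\<close>

lemma map_poly_of_int_mult:
  "map_poly of_int (p * q) = map_poly of_int p * (map_poly of_int q :: 'a::{comm_ring_1,ring_char_0} poly)"
  by (rule poly_eqI) (simp add: coeff_map_poly coeff_mult)

lemma map_poly_of_int_diff:
  "map_poly of_int (p - q) = map_poly of_int p - (map_poly of_int q :: 'a::{comm_ring_1,ring_char_0} poly)"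
  by (rule poly_eqI) (simp add: coeff_map_poly)

lemma map_poly_of_int_sum:
  "map_poly of_int (\<Sum>i\<in>A. f i) = (\<Sum>i\<in>A. map_poly of_int (f i) :: 'a::{comm_ring_1,ring_char_0} poly)"
  by (rule poly_eqI) (simp add: coeff_map_poly coeff_sum)

lemma map_poly_of_int_power:
  "map_poly of_int (p ^ n) = (map_poly of_int p :: 'a::{comm_ring_1,ring_char_0} poly) ^ n"
  by (induction n) (simp_all add: map_poly_of_int_mult)

lemma map_poly_of_int_of_int:
  "map_poly of_int (of_int c) = (of_int c :: 'a::{comm_ring_1,ring_char_0} poly)"
  by (simp add: of_int_poly map_poly_pCons)

text \<open>Row \<open>i\<close> of the matrix is the expansion of \<open>(X ^ i - 1) * u ^ m\<close> in the basis \<open>X ^ j - 1\<close>, where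
  \<open>u = 1 + X + \<dots> + X ^ (k - 1)\<close>.\<close>

lemma cyclotomic_unit_power_matrix:
  assumes "N \<ge> 2" "coprime k N"
  obtains m y where "m > 0" "unimodular N y" "odd_diagonal N y"
    "\<And>z i. \<lbrakk>z ^ N = (1::complex); i \<in> {1..<N}\<rbrakk> \<Longrightarrow>
      (\<Sum>j\<in>{1..<N}. of_int (y i j) * (z ^ j - 1)) = (\<Sum>s<k. z ^ s) ^ m * (z ^ i - 1)"
proof -
  define u where "u = (\<Sum>s<k. X ^ s)"
  have "k \<noteq> 0" using assms by (intro notI) simp
  then obtain l q where l: "k * l = N * q + 1"
    using bezout_nat[of k N] assms(2) by auto
  \<comment> \<open>\<open>w\<close> inverts \<open>u\<close> on the ideal:
    \<open>(X - 1) * u * w\<close> telescopes to \<open>X ^ (k * l) - 1\<close>, and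
    \<open>k * l\<close> is 1 modulo \<open>N\<close>.\<close>
  define w where "w = (\<Sum>t<l. (X ^ k) ^ t)"
  let ?Q = "X ^ N - 1"
  have N: "N > 0" using assms(1) by simp
  have "(X - 1) * (u * w - 1) = (X ^ k - 1) * w - (X - 1)"
    by (simp add: u_def power_diff_1_eq[of X k] algebra_simps)
  also have "(X ^ k - 1) * w = X ^ (k * l) - 1"
    by (simp only: w_def power_diff_1_eq[of "X ^ k" l, symmetric] power_mult)
  also have "X ^ (k * l) - 1 - (X - 1) = X ^ (k * l) - X ^ (k * l mod N)"
    using assms(1) unfolding l by (simp only: mod_mult_self4 mod_less) (simp add: algebra_simps)
  finally have "?Q dvd (X - 1) * (u * w - 1)"
    by (simp only: X_power_mod)
  \<comment> \<open>The factor \<open>X - 1\<close> has to stay: \<open>u * w - 1\<close> need not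
    vanish at 1.\<close>
  then have inverse: "?Q dvd (X - 1) * ((u * w) ^ n - 1)" for n
    by (meson dvd_trans mult_dvd_mono dvd_refl power_minus_one_dvd)

  define rep where "rep f = (SOME a. ?Q dvd f - augmentation_comb N a)" for f
  have rep: "?Q dvd f - augmentation_comb N (rep f)" if "poly f 1 = 0" for f
    unfolding rep_def using augmentation_rep[OF N that] by (rule someI_ex)

  \<comment> \<open>The parity pattern of the coordinates of \<open>(X - 1) * u ^ n\<close>. There
    are finitely many patterns, so two exponents share one.\<close>
  define S where "S n = {j \<in> {1..<N}. odd (rep ((X - 1) * u ^ n) j)}" for n :: nat
  have "range S \<subseteq> Pow {1..<N}" by (auto simp: S_def)
  then have "finite (range S)" by (rule finite_subset) simp
  then have "\<not> inj S"
    using finite_imageD infinite_UNIV_nat by blast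
  then obtain a b where ab: "a < b" "S a = S b"
    unfolding inj_def by (metis linorder_neqE_nat)
  define m where "m = b - a"
  have "m > 0" and b: "b = a + m" using ab by (auto simp: m_def)

  define t where "t j = (rep ((X - 1) * u ^ b) j - rep ((X - 1) * u ^ a) j) div 2" for j
  have t: "2 * t j = rep ((X - 1) * u ^ b) j - rep ((X - 1) * u ^ a) j" if "j \<in> {1..<N}" for j
  proof -
    have "j \<in> S a \<longleftrightarrow> j \<in> S b" using ab(2) by simp
    with that show ?thesis by (simp add: S_def t_def)
  qed
  have tt: "augmentation_comb N (rep ((X - 1) * u ^ b)) - augmentation_comb N (rep ((X - 1) * u ^ a))
      = 2 * augmentation_comb N t"
    unfolding augmentation_comb_diff using augmentation_comb_cmult[of 2 N t] t
    by (simp add: augmentation_comb_def)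
  have "X - 1 dvd augmentation_comb N t"
    unfolding augmentation_comb_def by (intro dvd_sum dvd_mult power_minus_one_dvd)
  then obtain g where g: "augmentation_comb N t = (X - 1) * g" by (elim dvdE)
  have "?Q dvd ((X - 1) * u ^ b - augmentation_comb N (rep ((X - 1) * u ^ b)))
      - ((X - 1) * u ^ a - augmentation_comb N (rep ((X - 1) * u ^ a)))"
    by (intro dvd_diff rep) simp_all
  also have "\<dots> = (X - 1) * u ^ b - (X - 1) * u ^ a - 2 * ((X - 1) * g)"
    by (simp only: tt[unfolded g, symmetric])
  finally have ab_cong: "?Q dvd (X - 1) * u ^ b - (X - 1) * u ^ a - 2 * ((X - 1) * g)" .
  \<comment> \<open>Multiplication by \<open>w ^ a\<close> cancels \<open>u ^ a\<close>, so
    \<open>u ^ m\<close> acts on the ideal as \<open>1 + 2 * h\<close>.\<close>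
  define h where "h = g * w ^ a"
  have "?Q dvd ((X - 1) * u ^ b - (X - 1) * u ^ a - 2 * ((X - 1) * g)) * w ^ a
      - (X - 1) * ((u * w) ^ a - 1) * (u ^ m - 1)"
    by (intro dvd_diff dvd_mult2 ab_cong inverse)
  also have "\<dots> = (X - 1) * (u ^ m - 1 - 2 * h)"
    unfolding b h_def power_add power_mult_distrib by algebra
  finally have mod2: "?Q dvd (X - 1) * (u ^ m - 1 - 2 * h)" .

  have lift: "?Q dvd (X ^ i - 1) * f" if "?Q dvd (X - 1) * f" for i f
    using that by (meson dvd_trans mult_dvd_mono dvd_refl power_minus_one_dvd)
  define y where "y i = rep ((X ^ i - 1) * u ^ m)" for i
  have y: "?Q dvd (X ^ i - 1) * u ^ m - augmentation_comb N (y i)" for i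
    unfolding y_def by (rule rep) simp

  show ?thesis
  proof (rule that)
    show "m > 0" by fact
    show "odd_diagonal N y"
      unfolding odd_diagonal_def
    proof (intro ballI)
      fix i j assume i: "i \<in> {1..<N}" and j: "j \<in> {1..<N}"
      \<comment> \<open>Row \<open>i\<close> of \<open>y\<close> is the unit row plus twice these
        coordinates.\<close>
      define c where "c = rep ((X ^ i - 1) * h)"
      have c: "?Q dvd (X ^ i - 1) * h - augmentation_comb N c"
        unfolding c_def by (rule rep) simp
      have "?Q dvd ((X ^ i - 1) * u ^ m - augmentation_comb N (y i))
          - (X ^ i - 1) * (u ^ m - 1 - 2 * h)
          - ((X ^ i - 1) * h - augmentation_comb N c) * 2"
        by (intro dvd_diff dvd_mult2 y c lift mod2)
      also have "\<dots> = augmentation_comb N (\<lambda>j. if j = i then 1 else 0) - augmentation_comb N (y i)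
          + of_int 2 * augmentation_comb N c"
        unfolding augmentation_comb_unit[OF i] by (simp add: algebra_simps)
      also have "\<dots> = augmentation_comb N (\<lambda>j. (if j = i then 1 else 0) - y i j - (-2) * c j)"
        unfolding augmentation_comb_diff[symmetric] augmentation_comb_cmult[symmetric] by simp
      finally have "(if j = i then 1 else 0) - y i j - (-2) * c j = 0"
        using j by (rule augmentation_comb_unique)
      then have "y i j = (if j = i then 1 else 0) + 2 * c j" by simp
      then show "odd (y i j) \<longleftrightarrow> i = j" by simp
    qed
    show "unimodular N y"
      unfolding unimodular_def
    proof
      fix c assume c: "c \<in> {1..<N}"
      \<comment> \<open>Since \<open>w\<close> inverts \<open>u\<close>, multiplying
        \<open>(X ^ c - 1) * w ^ m\<close> by \<open>u ^ m\<close> returns \<open>X ^ c - 1\<close>;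
        its coordinates are therefore a row of the inverse matrix.\<close>
      define b where "b = rep ((X ^ c - 1) * w ^ m)"
      have b: "?Q dvd (X ^ c - 1) * w ^ m - augmentation_comb N b"
        unfolding b_def by (rule rep) simp
      have "?Q dvd ((X ^ c - 1) * w ^ m - augmentation_comb N b) * u ^ m
          - (X ^ c - 1) * ((u * w) ^ m - 1)
          + (\<Sum>i\<in>{1..<N}. of_int (b i) * ((X ^ i - 1) * u ^ m - augmentation_comb N (y i)))"
        by (intro dvd_add dvd_diff dvd_mult2 b lift inverse dvd_sum dvd_mult[OF y])
      also have "(\<Sum>i\<in>{1..<N}. of_int (b i) * ((X ^ i - 1) * u ^ m - augmentation_comb N (y i)))
          = augmentation_comb N b * u ^ m - augmentation_comb N (\<lambda>j. \<Sum>i\<in>{1..<N}. b i * y i j)"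
        unfolding augmentation_comb_sum[symmetric] augmentation_comb_def[of N b]
          sum_distrib_right sum_subtractf[symmetric]
        by (intro sum.cong) (simp_all add: algebra_simps)
      also have "((X ^ c - 1) * w ^ m - augmentation_comb N b) * u ^ m
          - (X ^ c - 1) * ((u * w) ^ m - 1) + (augmentation_comb N b * u ^ m
          - augmentation_comb N (\<lambda>j. \<Sum>i\<in>{1..<N}. b i * y i j))
          = (X ^ c - 1) - augmentation_comb N (\<lambda>j. \<Sum>i\<in>{1..<N}. b i * y i j)"
        unfolding power_mult_distrib by algebra
      finally have "?Q dvd augmentation_comb N
          (\<lambda>j. (if j = c then 1 else 0) - (\<Sum>i\<in>{1..<N}. b i * y i j))"
        unfolding augmentation_comb_unit[OF c, symmetric] augmentation_comb_diff .
      then have "\<forall>j\<in>{1..<N}. (\<Sum>i\<in>{1..<N}. b i * y i j) = (if j = c then 1 else 0)"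
        using augmentation_comb_unique by fastforce
      then show "\<exists>b. \<forall>j\<in>{1..<N}. (\<Sum>i\<in>{1..<N}. b i * y i j) = (if j = c then 1 else 0)"
        by blast
    qed
    show "(\<Sum>j\<in>{1..<N}. of_int (y i j) * (z ^ j - 1)) = (\<Sum>s<k. z ^ s) ^ m * (z ^ i - 1)"
      if z: "z ^ N = 1" for z :: complex and i
    proof -
      \<comment> \<open>Evaluation at \<open>z\<close> kills every multiple of
        \<open>X ^ N - 1\<close>.\<close>
      obtain r where r: "(X ^ i - 1) * u ^ m - augmentation_comb N (y i) = ?Q * r"
        using y[of i] by (elim dvdE)
      have X: "poly (map_poly of_int (X ^ j)) z = z ^ j" for j
        by (simp add: map_poly_of_int_power map_poly_pCons)
      have u: "poly (map_poly of_int u) z = (\<Sum>s<k. z ^ s)"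
        by (simp add: u_def map_poly_of_int_sum poly_sum X)
      have "poly (map_poly of_int ((X ^ i - 1) * u ^ m - augmentation_comb N (y i))) z = 0"
        unfolding r by (simp add: map_poly_of_int_mult map_poly_of_int_diff X z)
      then show ?thesis
        by (simp add: map_poly_of_int_mult map_poly_of_int_diff map_poly_of_int_sum
            map_poly_of_int_of_int map_poly_of_int_power[of u] X u augmentation_comb_def
            poly_sum mult.commute)
    qed
  qed
qed

subsection \<open>Enlarging the polygon\<close>

text \<open>Take 2 for odd \<open>N\<close>, \<open>N / 2 - 1\<close> for \<open>N\<close> divisible
  by 4, and \<open>N / 2 - 2\<close> for the remaining even \<open>N\<close>.\<close>

lemma exists_coprime_below_half:
  assumes "N \<ge> 3" "N \<notin> {3, 4, 6 :: nat}"
  obtains k where "1 < k" "2 * k < N" "coprime k N"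
proof (cases "even N")
  case False
  then show ?thesis using that[of 2] assms by auto
next
  case True
  then obtain h where h: "N = 2 * h" by blast
  show ?thesis
  proof (cases "even h")
    case True
    then have "coprime (h - 1) (2 * h)"
      using assms h coprime_diff_one_left_nat[of h] by auto
    moreover have "h \<noteq> 2" using assms h by auto
    ultimately show ?thesis using that[of "h - 1"] assms h True by (auto elim!: evenE)
  next
    case False
    then obtain m where m: "h = 2 * m + 1" by (elim oddE)
    then have m2: "m \<ge> 2" using assms h by (cases m rule: nat.exhaust) auto
    have "d dvd 1" if d: "d dvd 2 * m - 1" "d dvd N" for d
    proof -
      have "d dvd N - 2 * (2 * m - 1)" using d(2) dvd_mult[OF d(1), of 2] by (rule dvd_diff_nat)
      also have "N - 2 * (2 * m - 1) = 2 ^ 2" using h m m2 by simp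
      finally have "d dvd 2 ^ 2" .
      moreover have "coprime (2 * m - 1) (2 ^ 2)"
        using m2 by (simp only: coprime_power_right_iff coprime_right_2_iff_odd) simp
      ultimately show "d dvd 1"
        using d(1) by (metis coprime_common_divisor)
    qed
    then have "coprime (2 * m - 1) N" by (intro coprimeI) auto
    then show ?thesis using that[of "2 * m - 1"] h m m2 by auto
  qed
qed

lemma norm_cis_minus_one: "(norm (cis t - 1))\<^sup>2 = 2 - 2 * cos t"
  by (simp add: cmod_power2 power2_diff)

text \<open>The geometric sum is a quotient of two chords of the unit circle, with angles
  \<open>k * t\<close> and \<open>t\<close> for \<open>t = 2 * pi / N\<close>. Chords grow with the
  angle up to \<open>pi\<close>, and \<open>t < k * t < pi\<close>.\<close>

lemma norm_cyclotomic_unit_gt_one: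
  assumes "1 < k" "2 * k < N" "m > 0"
  shows "norm ((\<Sum>s<k. cis (2 * pi / real N) ^ s) ^ m) > 1"
proof -
  let ?t = "2 * pi / real N"
  have "real k * ?t < pi"
    using assms by (simp add: field_simps)
  moreover have "?t < real k * ?t" "0 \<le> ?t"
    using assms by (simp_all add: field_simps)
  ultimately have "cos (real k * ?t) < cos ?t" "cos ?t < 1"
    using cos_monotone_0_pi[of ?t "real k * ?t"] cos_monotone_0_pi[of 0 ?t] assms by auto
  then have "(norm (cis ?t - 1))\<^sup>2 < (norm (cis (real k * ?t) - 1))\<^sup>2" "cis ?t \<noteq> 1"
    unfolding norm_cis_minus_one by (auto simp: complex_eq_iff)
  then have "norm (cis ?t - 1) < norm (cis (real k * ?t) - 1)"
    using power_less_imp_less_base norm_ge_zero by blast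
  also have "cis (real k * ?t) - 1 = (cis ?t - 1) * (\<Sum>s<k. cis ?t ^ s)"
    using power_diff_1_eq[of "cis ?t" k] by (simp only: Complex.DeMoivre)
  finally have "1 < norm (\<Sum>s<k. cis ?t ^ s)"
    using \<open>cis ?t \<noteq> 1\<close> by (simp add: norm_mult)
  then show ?thesis
    using assms(3) by (simp add: norm_power one_less_power)
qed

definition plane :: "complex \<Rightarrow> real^2" where
  "plane z = vector [Re z, Im z]"

lemma linear_plane: "linear plane"
  by (intro linearI) (simp_all add: plane_def vec_eq_iff forall_2)

lemma plane_of_real_mult: "plane (of_real a * z) = a *\<^sub>R plane z"
  by (simp add: plane_def vec_eq_iff forall_2)

definition rotation :: "real \<Rightarrow> real^2^2" where
  "rotation t = vector [vector [cos t, - sin t], vector [sin t, cos t]]"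

lemma orthogonal_rotation: "orthogonal_matrix (rotation t)"
  by (simp add: orthogonal_matrix rotation_def vec_eq_iff forall_2 matrix_matrix_mult_def
      transpose_def mat_def sum_2 flip: power2_eq_square)

lemma rotation_plane: "rotation t *v plane z = plane (cis t * z)"
  by (simp add: rotation_def plane_def vec_eq_iff forall_2 matrix_vector_mult_def sum_2)

text \<open>Under \<open>plane\<close>, the matrix multiplies every difference
  \<open>C i - C 0\<close> by the same complex number \<alpha>: a rotation by
  \<open>Arg \<alpha>\<close> and a scaling by \<open>norm \<alpha>\<close>.\<close>

lemma enlarge_cyclic_polygon:
  assumes N: "N \<ge> 3" "N \<notin> {3, 4, 6}"
    and C: "\<And>i. i < N \<Longrightarrow> C i = c + r *\<^sub>R vector [cos (\<theta> + 2 * pi * real i / real N),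
                                          sin (\<theta> + 2 * pi * real i / real N)]"
  shows "\<exists>q. (legal_move N)\<^sup>*\<^sup>* C q \<and> similar_larger N C q"
proof -
  obtain k where k: "1 < k" "2 * k < N" "coprime k N"
    using exists_coprime_below_half[OF N] .
  define z where "z = cis (2 * pi / real N)"
  have "z ^ N = 1"
    using N by (simp add: z_def Complex.DeMoivre)
  obtain m y where "m > 0" and y: "unimodular N y" "odd_diagonal N y"
    and eigen: "\<And>z i. \<lbrakk>z ^ N = (1::complex); i \<in> {1..<N}\<rbrakk> \<Longrightarrow>
      (\<Sum>j\<in>{1..<N}. of_int (y i j) * (z ^ j - 1)) = (\<Sum>s<k. z ^ s) ^ m * (z ^ i - 1)"
    using cyclotomic_unit_power_matrix[OF _ k(3)] N(1) by auto
  define \<alpha> where "\<alpha> = (\<Sum>s<k. z ^ s) ^ m"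
  have "norm \<alpha> > 1"
    unfolding \<alpha>_def z_def by (rule norm_cyclotomic_unit_gt_one) fact+
  have Cz: "C i = c + r *\<^sub>R plane (cis \<theta> * z ^ i)" if "i < N" for i
    using C[OF that] by (simp add: plane_def z_def Complex.DeMoivre cis_mult mult.commute flip: cis.simps)
  have diff: "C i - C 0 = r *\<^sub>R plane (cis \<theta> * (z ^ i - 1))" if "i < N" for i
    using that N Cz[of i] Cz[of 0]
    by (simp add: right_diff_distrib linear_diff[OF linear_plane] scaleR_diff_right)
  let ?S = "rotation (Arg \<alpha>)"
  have scale: "norm \<alpha> *\<^sub>R (?S *v (C i - C 0)) = r *\<^sub>R plane (cis \<theta> * (\<alpha> * (z ^ i - 1)))"
    if "i < N" for i
  proof -
    have "norm \<alpha> *\<^sub>R (?S *v (C i - C 0))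
        = r *\<^sub>R plane (of_real (norm \<alpha>) * (cis (Arg \<alpha>) * (cis \<theta> * (z ^ i - 1))))"
      by (simp add: diff[OF that] matrix_vector_mult_scaleR rotation_plane plane_of_real_mult)
    also have "of_real (norm \<alpha>) * (cis (Arg \<alpha>) * (cis \<theta> * (z ^ i - 1)))
        = cis \<theta> * (\<alpha> * (z ^ i - 1))"
      using Arg_eq[of \<alpha>] by (cases "\<alpha> = 0") (simp_all add: cis_conv_exp mult_ac)
    finally show ?thesis .
  qed
  \<comment> \<open>The translation part is chosen so that \<open>C 0\<close> is the fixed point of
    the similarity.\<close>
  have "combine N C y i = norm \<alpha> *\<^sub>R (?S *v C i) + (C 0 - norm \<alpha> *\<^sub>R (?S *v C 0))"
    if "i < N" for i
  proof -
    have "combine N C y i = C 0 + r *\<^sub>R plane (cis \<theta> * (\<alpha> * (z ^ i - 1)))"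
    proof (cases "i = 0")
      case True
      then show ?thesis
        by (simp add: combine_def linear_0[OF linear_plane])
    next
      case False
      with that have i: "i \<in> {1..<N}" by simp
      have "(\<Sum>j\<in>{1..<N}. of_int (y i j) *\<^sub>R (C j - C 0))
          = (\<Sum>j\<in>{1..<N}. r *\<^sub>R plane (cis \<theta> * (of_int (y i j) * (z ^ j - 1))))"
        by (intro sum.cong refl)
          (simp add: diff mult_ac flip: plane_of_real_mult)
      also have "\<dots> = r *\<^sub>R plane (cis \<theta> * (\<Sum>j\<in>{1..<N}. of_int (y i j) * (z ^ j - 1)))"
        by (simp add: sum_distrib_left linear_sum[OF linear_plane] scaleR_sum_right)
      finally show ?thesis
        using i eigen[OF \<open>z ^ N = 1\<close> i] by (simp add: combine_def \<alpha>_def)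
    qed
    then show ?thesis
      using scale[OF that] by (simp add: matrix_vector_mult_diff_distrib algebra_simps)
  qed
  then have "similar_larger N C (combine N C y)"
    unfolding similar_larger_def using \<open>norm \<alpha> > 1\<close> orthogonal_rotation[of "Arg \<alpha>"]
    by (intro exI[of _ "norm \<alpha>"] exI[of _ ?S] exI[of _ "C 0 - norm \<alpha> *\<^sub>R (?S *v C 0)"]) auto
  then show ?thesis
    using legal_moves_combine[OF N(1) y] by blast
qed

text \<open>Moves treat all pieces alike. The relabelling permutes all natural numbers because
  configurations are compared as total functions.\<close>

lemma legal_moves_relabel:
  assumes "(legal_move N)\<^sup>*\<^sup>* p q" "bij \<sigma>" "\<And>i. \<sigma> i < N \<longleftrightarrow> i < N"
  shows "(legal_move N)\<^sup>*\<^sup>* (p \<circ> \<sigma>) (q \<circ> \<sigma>)"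
  using assms(1)
proof (induction rule: rtranclp_induct)
  case (step p' q')
  from step(2) have "legal_move N (p' \<circ> \<sigma>) (q' \<circ> \<sigma>)"
  proof cases
    case (jump i j)
    obtain i' j' where ij: "i = \<sigma> i'" "j = \<sigma> j'"
      using assms(2) by (metis bij_pointE)
    have "q' \<circ> \<sigma> = (p' \<circ> \<sigma>)(i' := 2 *\<^sub>R (p' \<circ> \<sigma>) j' - (p' \<circ> \<sigma>) i')"
      using assms(2) by (auto simp: jump(1) ij fun_eq_iff bij_def inj_eq)
    then show ?thesis
      using legal_move.jump[of i' N j' "p' \<circ> \<sigma>"] jump assms(3) ij by auto
  qed
  with step.IH show ?case by (elim rtranclp.rtrancl_into_rtrancl)
qed simp

theorem theorem1p1:
  fixes N :: nat and C :: config
  assumes "N \<ge> 3"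
    and "regular_polygon_config N C"
    and "N \<notin> {3, 4, 6}"
  shows "\<exists>q. (legal_move N)\<^sup>*\<^sup>* C q \<and> similar_larger N C q"
proof -
  obtain c r \<theta> where bij: "bij_betw C {..<N} (regular_polygon_vertices N c r \<theta>)"
    using assms(2) unfolding regular_polygon_config_def by blast
  define V where "V i = c + r *\<^sub>R vector [cos (\<theta> + 2 * pi * real i / real N),
                                  sin (\<theta> + 2 * pi * real i / real N)]" for i :: nat
  \<comment> \<open>The same polygon numbered cyclically; beyond \<open>N\<close> it copies
    \<open>C\<close>, so that \<open>C = D \<circ> \<sigma>\<close> holds everywhere.\<close>
  define D where "D i = (if i < N then V i else C i)" for i
  have vertices: "regular_polygon_vertices N c r \<theta> = V ` {..<N}"
    by (simp add: regular_polygon_vertices_def V_def)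
  \<comment> \<open>The vertices are distinct by counting: the bijection \<open>C\<close> shows that
    there are \<open>N\<close> of them.\<close>
  have "card (V ` {..<N}) = card {..<N}"
    using bij_betw_same_card[OF bij] vertices by simp
  then have "inj_on V {..<N}"
    by (simp add: eq_card_imp_inj_on)
  then have "bij_betw V {..<N} (V ` {..<N})"
    by (rule inj_on_imp_bij_betw)
  \<comment> \<open>Piece \<open>i\<close> of \<open>C\<close> stands on vertex number
    \<open>\<sigma> i\<close>.\<close>
  define \<sigma> where "\<sigma> i = (if i < N then inv_into {..<N} V (C i) else i)" for i
  have "bij_betw (inv_into {..<N} V \<circ> C) {..<N} {..<N}"
    using bij_betw_trans[OF bij[unfolded vertices] bij_betw_inv_into] \<open>bij_betw V _ _\<close> by blast
  then have \<sigma>: "bij_betw \<sigma> {..<N} {..<N}"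
    by (rule bij_betw_cong[THEN iffD1, rotated]) (simp add: \<sigma>_def)
  have outside: "\<sigma> i = i" if "\<not> i < N" for i
    using that by (simp add: \<sigma>_def)
  have \<sigma>_less: "\<sigma> i < N \<longleftrightarrow> i < N" for i
    using bij_betwE[OF \<sigma>] outside[of i] by (cases "i < N") auto
  have "bij_betw \<sigma> (- {..<N}) (- {..<N})"
    by (rule bij_betw_cong[THEN iffD1, rotated, OF bij_betw_id]) (simp add: outside)
  with \<sigma> have "bij_betw \<sigma> ({..<N} \<union> - {..<N}) ({..<N} \<union> - {..<N})"
    by (rule bij_betw_combine) auto
  then have "bij \<sigma>"
    by (simp only: Compl_partition)
  have C: "C = D \<circ> \<sigma>"
  proof
    fix i
    show "C i = (D \<circ> \<sigma>) i"
    proof (cases "i < N")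
      case True
      then have "C i \<in> V ` {..<N}"
        using bij_betwE[OF bij] vertices by auto
      with True \<sigma>_less[of i] show ?thesis
        by (auto simp: D_def \<sigma>_def f_inv_into_f)
    qed (simp add: D_def outside)
  qed
  obtain q where q: "(legal_move N)\<^sup>*\<^sup>* D q" "similar_larger N D q"
    using enlarge_cyclic_polygon[OF assms(1,3), of D c r \<theta>] by (auto simp: D_def V_def)
  have "(legal_move N)\<^sup>*\<^sup>* C (q \<circ> \<sigma>)"
    unfolding C by (rule legal_moves_relabel) fact+
  moreover have "similar_larger N C (q \<circ> \<sigma>)"
    using q(2) \<sigma>_less unfolding similar_larger_def C by (metis comp_apply)
  ultimately show ?thesis by blast
qed

end
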